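(* Let $X$ be a finite-dimensional real normed space with norm $\lVert\cdot\rVert$, let $\Omega\subset X$ be a closed cone, and let $T:\Omega\to\Omega$ be continuous and positively homogeneous of degree one. Then the following statements are equivalent. (i) For every $x\in\Omega$, one has $T^k(x)\to 0$ as $k\to\infty$. (ii) There exist $C\ge 1$ and $\rho\in(0,1)$ such that $$\lVert T^k(x)\rVert\le C\rho^k\lVert x\rVert\qquad\text{for all }x\in\Omega,\ k\ge 0.$$ (iii) There exist an integer $N\ge 1$ and $\theta\in(0,1)$ such that $$\lVert T^N(x)\rVert\le\theta\lVert x\rVert\qquad\text{for all }x\in\Omega.$$
   Context: A nonempty set $\Omega\subset X$ is called a closed cone if it is closed, $0\in\Omega$, and $tx\in\Omega$ whenever $x\in\Omega$ and $t\ge 0$ (no convexity is required). A map $T:\Omega\to\Omega$ is positively homogeneous of degree one if $T(tx)=tT(x)$ for all $t\ge 0$ and $x\in\Omega$ (no linearity is assumed). $T^k$ denotes the $k$-fold composition, with $T^0$ the identity. *)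

theory Defs
  imports "HOL-Analysis.Analysis"
begin

text \<open>The class \<open>euclidean_space\<close> would force an inner-product norm; an arbitrary norm on a
  finite-dimensional space is obtained from \<open>real_normed_vector\<close> with a finite spanning set.\<close>

definition finite_dimensional :: "'a::real_normed_vector itself \<Rightarrow> bool" where
  "finite_dimensional _ \<longleftrightarrow> (\<exists>B :: 'a set. finite B \<and> span B = UNIV)"

definition closed_cone :: "'a::real_normed_vector set \<Rightarrow> bool" where
  "closed_cone \<Omega> \<longleftrightarrow> \<Omega> \<noteq> {} \<and> closed \<Omega> \<and> 0 \<in> \<Omega> \<and> cone \<Omega>"

definition pos_homogeneous_on :: "'a::real_normed_vector set \<Rightarrow> ('a \<Rightarrow> 'a) \<Rightarrow> bool" where
  "pos_homogeneous_on \<Omega> T \<longleftrightarrow> (\<forall>t\<ge>0. \<forall>x\<in>\<Omega>. T (t *\<^sub>R x) = t *\<^sub>R T x)"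

end

theory Submission imports Defs begin

text \<open>
  The substantial implication is from pointwise convergence to the uniform exponential bound. In
  finite dimension the unit vectors of the cone form a compact set. Each of them has an iterate of
  norm below \<open>1/2\<close>, and by continuity the same iterate works nearby, so finitely many iterates
  suffice. By homogeneity there is then an \<open>N\<close> such that every orbit shrinks by the factor \<open>1/2\<close>
  within at most \<open>N\<close> steps, wherever in the cone it is. The number of steps depends on the point, but
  since after each shrinking the orbit is again in the cone, the shrinkings can be chained; between
  two of them the norm grows at most by a fixed factor, because \<open>\<parallel>T x\<parallel> \<le> L \<parallel>x\<parallel>\<close> for some \<open>L\<close>
  (compactness once more). This chaining is \<open>geometric_decay_from_recurrent_contraction\<close>. A uniform
  contraction of a single power \<open>T\<^sup>N\<close> is the case where the number of steps is always \<open>N\<close>, so the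
  same lemma also brings statement (iii) back to (ii). The other implications are immediate.

  The norm need not come from an inner product, so compactness is derived for an arbitrary norm, by
  induction on a finite spanning set.
\<close>

section \<open>Compactness of balls in finite-dimensional normed spaces\<close>

lemma closed_if_compact_Int_cballs:
  fixes S :: "'a::real_normed_vector set"
  assumes "\<And>r. compact (cball 0 r \<inter> S)"
  shows "closed S"
  unfolding closed_sequential_limits
proof (intro allI impI, elim conjE)
  fix x l assume x: "\<forall>n. x n \<in> S" "x \<longlonglongrightarrow> l"
  then have "bounded (range x)"
    using convergent_imp_bounded by blast
  then obtain r where "\<And>n. norm (x n) \<le> r"
    by (auto simp: bounded_iff)
  with x have "\<forall>n. x n \<in> cball 0 r \<inter> S" by simp
  with compact_imp_closed[OF assms] x(2) have "l \<in> cball 0 r \<inter> S"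
    unfolding closed_sequential_limits by blast
  then show "l \<in> S" by simp
qed

text \<open>Adjoining \<open>b\<close> to a closed subspace \<open>span B\<close> that omits it keeps both coordinates of
  \<open>t *\<^sub>R b + y\<close> under control: the distance \<open>d > 0\<close> from \<open>b\<close> to \<open>span B\<close> gives
  \<open>\<bar>t\<bar> * d \<le> \<parallel>t *\<^sub>R b + y\<parallel>\<close>, and \<open>y\<close> is then bounded too. So a ball of the larger span is a closed
  part of the continuous image of an interval times a smaller ball. Closedness of \<open>span B\<close> itself
  comes from the induction hypothesis for all radii.\<close>

lemma compact_cball_Int_span:
  fixes B :: "'a::real_normed_vector set"
  assumes "finite B"
  shows "compact (cball 0 r \<inter> span B)"
  using assms
proof (induction B arbitrary: r rule: finite_induct)
  case empty
  have "cball 0 r \<inter> {0::'a} = (if r \<ge> 0 then {0} else {})" by auto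
  then show ?case by simp
next
  case (insert b B)
  show ?case
  proof (cases "b \<in> span B")
    case True
    then show ?thesis using insert.IH by (simp add: span_redundant)
  next
    case False
    have cl: "closed (span B)"
      using insert.IH by (rule closed_if_compact_Int_cballs)
    define d where "d = infdist b (span B)"
    have d0: "d > 0"
      unfolding d_def using False cl infdist_pos_not_in_closed[of "span B" b] span_zero by blast
    have coeff: "\<bar>t\<bar> * d \<le> norm (t *\<^sub>R b + y)" if y: "y \<in> span B" for t y
    proof (cases "t = 0")
      case False
      have "- ((1/t) *\<^sub>R y) \<in> span B" using y by (intro span_neg span_scale)
      then have "d \<le> dist b (- ((1/t) *\<^sub>R y))" unfolding d_def by (rule infdist_le)
      then have "\<bar>t\<bar> * d \<le> \<bar>t\<bar> * norm (b + (1/t) *\<^sub>R y)"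
        by (simp add: dist_norm mult_left_mono)
      also have "\<dots> = norm (t *\<^sub>R (b + (1/t) *\<^sub>R y))" by simp
      also have "t *\<^sub>R (b + (1/t) *\<^sub>R y) = t *\<^sub>R b + y"
        using False by (simp add: scaleR_add_right)
      finally show ?thesis .
    qed simp
    define s where "s = r + r / d * norm b"
    define K where "K = (\<lambda>(t, y). t *\<^sub>R b + y) ` ({- (r/d)..r/d} \<times> (cball 0 s \<inter> span B))"
    have "compact K" unfolding K_def
      by (intro compact_continuous_image compact_Times insert.IH compact_Icc)
        (auto intro!: continuous_on_add continuous_on_scaleR continuous_on_fst continuous_on_snd
           continuous_on_id continuous_on_const simp: case_prod_beta)
    moreover have "cball 0 r \<inter> span (insert b B) = cball 0 r \<inter> K"
    proof (intro equalityI subsetI)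
      fix x assume x: "x \<in> cball 0 r \<inter> span (insert b B)"
      then obtain t where t: "x - t *\<^sub>R b \<in> span B"
        by (auto simp: span_insert)
      define y where "y = x - t *\<^sub>R b"
      have xy: "x = t *\<^sub>R b + y" and y: "y \<in> span B"
        using t by (simp_all add: y_def)
      have "\<bar>t\<bar> * d \<le> r" using coeff[OF y, of t] x xy by simp
      then have tr: "\<bar>t\<bar> \<le> r / d" using d0 by (simp add: pos_le_divide_eq)
      have "norm y \<le> norm x + norm (t *\<^sub>R b)"
        unfolding y_def by (rule norm_triangle_ineq4)
      also have "\<dots> \<le> s"
        unfolding s_def norm_scaleR using x tr by (intro add_mono mult_right_mono) auto
      finally have "(t, y) \<in> {- (r/d)..r/d} \<times> (cball 0 s \<inter> span B)"
        using tr y by auto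
      then have "x \<in> K" unfolding K_def using xy by (intro image_eqI[of _ _ "(t, y)"]) simp_all
      with x show "x \<in> cball 0 r \<inter> K" by simp
    next
      fix x assume x: "x \<in> cball 0 r \<inter> K"
      then obtain t y where "x = t *\<^sub>R b + y" "y \<in> span B" unfolding K_def by auto
      then have "x - t *\<^sub>R b \<in> span B" by simp
      then have "x \<in> span (insert b B)" unfolding span_insert by blast
      with x show "x \<in> cball 0 r \<inter> span (insert b B)" by simp
    qed
    ultimately show ?thesis by (simp add: closed_Int_compact)
  qed
qed

lemma compact_closed_Int_unit_sphere:
  fixes S :: "'a::real_normed_vector set"
  assumes "finite_dimensional TYPE('a)" and "closed S"
  shows "compact (S \<inter> sphere 0 1)"
proof -
  obtain B :: "'a set" where "finite B" "span B = UNIV"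
    using assms(1) unfolding finite_dimensional_def by blast
  then have "compact (cball (0::'a) 1)" using compact_cball_Int_span[of B 1] by simp
  moreover have "closed (sphere (0::'a) 1)"
  proof -
    have "sphere (0::'a) 1 = {x. norm x = 1}" by auto
    also have "closed \<dots>" by (intro closed_Collect_eq continuous_intros)
    finally show ?thesis .
  qed
  ultimately have "compact ((S \<inter> sphere 0 1) \<inter> cball 0 1)"
    using assms(2) by (intro closed_Int_compact closed_Int)
  moreover have "(S \<inter> sphere 0 1) \<inter> cball 0 1 = S \<inter> sphere (0::'a) 1" by auto
  ultimately show ?thesis by simp
qed

section \<open>Positively homogeneous maps and their iterates\<close>

lemma funpow_maps_to:
  assumes "T \<in> S \<rightarrow> S" "x \<in> S"
  shows "(T ^^ k) x \<in> S"
  using assms by (induction k) auto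

lemma continuous_on_funpow:
  assumes "T \<in> S \<rightarrow> S" "continuous_on S T"
  shows "continuous_on S (T ^^ k)"
proof (induction k)
  case 0
  show ?case by (simp add: id_def)
next
  case (Suc k)
  have "(T ^^ k) ` S \<subseteq> S" using funpow_maps_to[OF assms(1)] by auto
  with assms(2) have "continuous_on ((T ^^ k) ` S) T" by (rule continuous_on_subset)
  with Suc show ?case unfolding funpow.simps by (rule continuous_on_compose)
qed

lemma pos_homogeneous_on_funpow:
  assumes "T \<in> S \<rightarrow> S" "pos_homogeneous_on S T"
  shows "pos_homogeneous_on S (T ^^ k)"
  using assms(2) funpow_maps_to[OF assms(1)]
  by (induction k) (auto simp: pos_homogeneous_on_def)

text \<open>Both sides scale alike along a ray, so the bound need only be checked on unit vectors.\<close>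

lemma homogeneous_bound_from_unit:
  assumes cone: "closed_cone \<Omega>" and hom: "pos_homogeneous_on \<Omega> f" and x: "x \<in> \<Omega>"
    and unit: "x \<noteq> 0 \<Longrightarrow> norm (f (x /\<^sub>R norm x)) \<le> c"
  shows "norm (f x) \<le> c * norm x"
proof (cases "x = 0")
  case True
  have "f (0 *\<^sub>R x) = 0 *\<^sub>R f x" using hom x unfolding pos_homogeneous_on_def by blast
  with True show ?thesis by simp
next
  case False
  have "x /\<^sub>R norm x \<in> \<Omega>"
    using cone x by (simp add: closed_cone_def cone_def)
  then have "f (norm x *\<^sub>R (x /\<^sub>R norm x)) = norm x *\<^sub>R f (x /\<^sub>R norm x)"
    using hom unfolding pos_homogeneous_on_def by (meson norm_ge_zero)
  then have "norm (f x) = norm x * norm (f (x /\<^sub>R norm x))" using False by simp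
  also have "\<dots> \<le> norm x * c" using unit[OF False] by (rule mult_left_mono) simp
  finally show ?thesis by (simp add: mult.commute)
qed

lemma normalize_in_cone:
  assumes "closed_cone \<Omega>" "x \<in> \<Omega>" "x \<noteq> 0"
  shows "x /\<^sub>R norm x \<in> \<Omega> \<inter> sphere 0 1"
  using assms by (simp add: closed_cone_def cone_def)

text \<open>A positively homogeneous continuous map is bounded like a linear one, because it is bounded on
  the compact set of unit vectors. Taking the constant at least \<open>1\<close> makes its powers monotone.\<close>

lemma homogeneous_continuous_bounded:
  fixes f :: "'a::real_normed_vector \<Rightarrow> 'a"
  assumes "finite_dimensional TYPE('a)" and cone: "closed_cone \<Omega>"
    and "continuous_on \<Omega> f" and hom: "pos_homogeneous_on \<Omega> f"
  obtains L where "L \<ge> 1" "\<And>x. x \<in> \<Omega> \<Longrightarrow> norm (f x) \<le> L * norm x"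
proof -
  have "compact (\<Omega> \<inter> sphere 0 1)"
    using assms(1) cone compact_closed_Int_unit_sphere by (auto simp: closed_cone_def)
  moreover have "continuous_on (\<Omega> \<inter> sphere 0 1) f"
    using assms(3) by (rule continuous_on_subset) blast
  ultimately have "bounded (f ` (\<Omega> \<inter> sphere 0 1))"
    by (intro compact_imp_bounded compact_continuous_image)
  then obtain M where M: "\<And>u. u \<in> \<Omega> \<inter> sphere 0 1 \<Longrightarrow> norm (f u) \<le> M"
    unfolding bounded_iff by blast
  show thesis
  proof (rule that[of "max 1 M"])
    fix x assume x: "x \<in> \<Omega>"
    show "norm (f x) \<le> max 1 M * norm x"
      using cone hom x
      by (rule homogeneous_bound_from_unit)
        (use M normalize_in_cone[OF cone x] in \<open>auto simp: le_max_iff_disj\<close>)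
  qed simp
qed

lemma funpow_norm_bound:
  fixes T :: "'a::real_normed_vector \<Rightarrow> 'a"
  assumes "T \<in> S \<rightarrow> S" and "L \<ge> 0" and "\<And>x. x \<in> S \<Longrightarrow> norm (T x) \<le> L * norm x" and "x \<in> S"
  shows "norm ((T ^^ k) x) \<le> L ^ k * norm x"
proof (induction k)
  case (Suc k)
  have "norm ((T ^^ Suc k) x) \<le> L * norm ((T ^^ k) x)"
    using assms(3) funpow_maps_to[OF assms(1,4)] by simp
  also have "\<dots> \<le> L * (L ^ k * norm x)" using Suc assms(2) by (rule mult_left_mono)
  finally show ?case by (simp add: mult_ac)
qed simp

section \<open>From contraction within boundedly many steps to exponential decay\<close>

text \<open>The rate \<open>\<rho>\<close> is the \<open>N\<close>-th root of \<open>\<theta>\<close>. Contracting by \<open>\<theta> = \<rho> ^ N\<close> after \<open>n \<le> N\<close> steps is at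
  least as good as contracting by \<open>\<rho> ^ n\<close>, so peeling off \<open>n\<close> steps preserves the bound
  \<open>C * \<rho> ^ k\<close>; the last, incomplete stretch of fewer than \<open>N\<close> steps costs \<open>L ^ N\<close>, and
  \<open>1 / \<theta>\<close> compensates for the factor \<open>\<rho> ^ k \<ge> \<theta>\<close> there.\<close>

lemma geometric_decay_from_recurrent_contraction:
  fixes T :: "'a::real_normed_vector \<Rightarrow> 'a"
  assumes maps: "T \<in> S \<rightarrow> S" and L: "L \<ge> 1" "\<And>x. x \<in> S \<Longrightarrow> norm (T x) \<le> L * norm x"
    and N: "N \<ge> 1" and \<theta>: "0 < \<theta>" "\<theta> < 1"
    and contr: "\<And>x. x \<in> S \<Longrightarrow> \<exists>n\<in>{1..N}. norm ((T ^^ n) x) \<le> \<theta> * norm x"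
  shows "\<exists>C \<rho> :: real. C \<ge> 1 \<and> 0 < \<rho> \<and> \<rho> < 1 \<and>
            (\<forall>x\<in>S. \<forall>k::nat. norm ((T ^^ k) x) \<le> C * \<rho> ^ k * norm x)"
proof -
  define \<rho> where "\<rho> = root N \<theta>"
  define C where "C = L ^ N / \<theta>"
  have \<rho>: "0 < \<rho>" "\<rho> < 1" and \<rho>N: "\<rho> ^ N = \<theta>"
    unfolding \<rho>_def using N \<theta> by auto
  have \<rho>_ge: "\<theta> \<le> \<rho> ^ n" if "n \<le> N" for n
    using power_decreasing[OF that, of \<rho>] \<rho> \<rho>N by simp
  have LN: "1 \<le> L ^ N" using L(1) by (rule one_le_power)
  have C: "C \<ge> 1" unfolding C_def using LN \<theta> by (simp add: pos_le_divide_eq)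
  have "norm ((T ^^ k) x) \<le> C * \<rho> ^ k * norm x" if "x \<in> S" for x k
    using that
  proof (induction k arbitrary: x rule: less_induct)
    case (less k)
    show ?case
    proof (cases "k < N")
      case True
      have "L ^ k \<le> L ^ N" using True L(1) by (intro power_increasing) auto
      also have "\<dots> = C * \<theta>" unfolding C_def using \<theta> by simp
      also have "\<dots> \<le> C * \<rho> ^ k" using \<rho>_ge[of k] True C by (intro mult_left_mono) auto
      finally have "L ^ k * norm x \<le> C * \<rho> ^ k * norm x" by (rule mult_right_mono) simp
      moreover have "norm ((T ^^ k) x) \<le> L ^ k * norm x"
        using funpow_norm_bound[OF maps _ L(2) less.prems] L(1) by simp
      ultimately show ?thesis by linarith
    next
      case False
      obtain n where n: "1 \<le> n" "n \<le> N" "norm ((T ^^ n) x) \<le> \<theta> * norm x"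
        using contr[OF less.prems] by auto
      have split: "k = (k - n) + n" using False n by simp
      have "(T ^^ k) x = (T ^^ (k - n)) ((T ^^ n) x)"
        by (subst split, subst funpow_add) simp
      then have "norm ((T ^^ k) x) \<le> C * \<rho> ^ (k - n) * norm ((T ^^ n) x)"
        using less.IH[of "k - n" "(T ^^ n) x"] funpow_maps_to[OF maps less.prems] n False N by simp
      also have "norm ((T ^^ n) x) \<le> \<rho> ^ n * norm x"
        using n(3) mult_right_mono[OF \<rho>_ge[OF n(2)] norm_ge_zero[of x]] by linarith
      also have "C * \<rho> ^ (k - n) * (\<rho> ^ n * norm x) = C * \<rho> ^ k * norm x"
        by (subst (2) split, subst power_add) simp
      finally show ?thesis using C \<rho> by (simp add: mult_left_mono)
    qed
  qed
  with C \<rho> show ?thesis by blast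
qed

text \<open>Each unit vector is brought below norm \<open>1/2\<close> by some iterate, and the points that a given
  iterate brings below \<open>1/2\<close> form a relatively open set; a finite subcover bounds the number of
  steps.\<close>

lemma recurrent_contraction_if_pointwise_convergent:
  fixes T :: "'a::real_normed_vector \<Rightarrow> 'a"
  assumes "finite_dimensional TYPE('a)" and cone: "closed_cone \<Omega>" and maps: "T \<in> \<Omega> \<rightarrow> \<Omega>"
    and cont: "continuous_on \<Omega> T" and hom: "pos_homogeneous_on \<Omega> T"
    and conv: "\<And>x. x \<in> \<Omega> \<Longrightarrow> (\<lambda>k. (T ^^ k) x) \<longlonglongrightarrow> 0"
  shows "\<exists>N\<ge>1. \<forall>x\<in>\<Omega>. \<exists>n\<in>{1..N}. norm ((T ^^ n) x) \<le> 1/2 * norm x"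
proof -
  let ?K = "\<Omega> \<inter> sphere 0 1"
  have "compact ?K"
    using assms(1) cone compact_closed_Int_unit_sphere by (auto simp: closed_cone_def)
  have "\<exists>A. open A \<and> A \<inter> ?K = (\<lambda>x. norm ((T ^^ k) x)) -` {..<1/2} \<inter> ?K" for k
  proof -
    have "continuous_on ?K (T ^^ k)"
      using continuous_on_funpow[OF maps cont] continuous_on_subset by blast
    then have "continuous_on ?K (\<lambda>x. norm ((T ^^ k) x))" by (rule continuous_on_norm)
    then show ?thesis
      unfolding continuous_on_open_invariant using open_lessThan[of "1/2 :: real"] by simp
  qed
  then obtain A where A: "\<And>k. open (A k)"
    "\<And>k. A k \<inter> ?K = (\<lambda>x. norm ((T ^^ k) x)) -` {..<1/2} \<inter> ?K" by metis
  have "?K \<subseteq> (\<Union>k\<in>UNIV. A k)"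
  proof
    fix u assume u: "u \<in> ?K"
    then have "\<forall>\<^sub>F k in sequentially. norm ((T ^^ k) u) < 1/2"
      using tendstoD[OF conv[of u], of "1/2"] by (simp add: dist_norm)
    then obtain k where "norm ((T ^^ k) u) < 1/2"
      using eventually_happens trivial_limit_sequentially by blast
    with u A(2)[of k] show "u \<in> (\<Union>k\<in>UNIV. A k)" by blast
  qed
  then obtain F where F: "finite F" "?K \<subseteq> (\<Union>k\<in>F. A k)"
    using compactE_image[OF \<open>compact ?K\<close>, of UNIV A] A(1) by metis
  define N where "N = Max (insert 1 F)"
  have "\<exists>n\<in>{1..N}. norm ((T ^^ n) x) \<le> 1/2 * norm x" if x: "x \<in> \<Omega>" for x
  proof (cases "x = 0")
    case True
    have "1 \<in> {1..N}" unfolding N_def using F(1) by simp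
    moreover have "norm ((T ^^ 1) x) \<le> 1/2 * norm x"
      using cone pos_homogeneous_on_funpow[OF maps hom] x
      by (rule homogeneous_bound_from_unit) (simp add: True)
    ultimately show ?thesis by blast
  next
    case False
    let ?u = "x /\<^sub>R norm x"
    have u: "?u \<in> ?K" using normalize_in_cone[OF cone x False] .
    then obtain n where n: "n \<in> F" "?u \<in> A n" using F(2) by blast
    then have small: "norm ((T ^^ n) ?u) < 1/2" using A(2)[of n] u by blast
    \<comment> \<open>The zeroth iterate leaves a unit vector of norm 1, so it cannot be the one chosen.\<close>
    have "n \<noteq> 0"
    proof
      assume "n = 0"
      with small u show False by simp
    qed
    then have "n \<in> {1..N}" unfolding N_def using F(1) n(1) by simp
    moreover have "norm ((T ^^ n) x) \<le> 1/2 * norm x"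
      using cone pos_homogeneous_on_funpow[OF maps hom] x
      by (rule homogeneous_bound_from_unit) (use small in simp)
    ultimately show ?thesis by blast
  qed
  moreover have "N \<ge> 1" unfolding N_def using F(1) by simp
  ultimately show ?thesis by blast
qed

section \<open>The equivalence\<close>

theorem theorem2p2:
  fixes \<Omega> :: "'a::real_normed_vector set" and T :: "'a \<Rightarrow> 'a"
  assumes "finite_dimensional TYPE('a)"
    and "closed_cone \<Omega>"
    and "T \<in> \<Omega> \<rightarrow> \<Omega>"
    and "continuous_on \<Omega> T"
    and "pos_homogeneous_on \<Omega> T"
  shows "((\<forall>x\<in>\<Omega>. (\<lambda>k. (T ^^ k) x) \<longlonglongrightarrow> 0)
      \<longleftrightarrow> (\<exists>C \<rho> :: real. C \<ge> 1 \<and> 0 < \<rho> \<and> \<rho> < 1 \<and>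
            (\<forall>x\<in>\<Omega>. \<forall>k::nat. norm ((T ^^ k) x) \<le> C * \<rho> ^ k * norm x)))
    \<and> ((\<exists>C \<rho> :: real. C \<ge> 1 \<and> 0 < \<rho> \<and> \<rho> < 1 \<and>
            (\<forall>x\<in>\<Omega>. \<forall>k::nat. norm ((T ^^ k) x) \<le> C * \<rho> ^ k * norm x))
      \<longleftrightarrow> (\<exists>(N::nat) (\<theta>::real). N \<ge> 1 \<and> 0 < \<theta> \<and> \<theta> < 1 \<and>
            (\<forall>x\<in>\<Omega>. norm ((T ^^ N) x) \<le> \<theta> * norm x)))"
proof -
  let ?conv = "\<forall>x\<in>\<Omega>. (\<lambda>k. (T ^^ k) x) \<longlonglongrightarrow> 0"
  let ?decay = "\<exists>C \<rho> :: real. C \<ge> 1 \<and> 0 < \<rho> \<and> \<rho> < 1 \<and>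
            (\<forall>x\<in>\<Omega>. \<forall>k::nat. norm ((T ^^ k) x) \<le> C * \<rho> ^ k * norm x)"
  let ?contr = "\<exists>(N::nat) (\<theta>::real). N \<ge> 1 \<and> 0 < \<theta> \<and> \<theta> < 1 \<and>
            (\<forall>x\<in>\<Omega>. norm ((T ^^ N) x) \<le> \<theta> * norm x)"
  obtain L where L: "L \<ge> 1" "\<And>x. x \<in> \<Omega> \<Longrightarrow> norm (T x) \<le> L * norm x"
    using homogeneous_continuous_bounded[OF assms(1,2,4,5)] by blast
  note geometric_decay = geometric_decay_from_recurrent_contraction[OF assms(3) L]

  have "?decay" if conv: ?conv
  proof -
    obtain N where N: "N \<ge> 1" "\<forall>x\<in>\<Omega>. \<exists>n\<in>{1..N}. norm ((T ^^ n) x) \<le> 1/2 * norm x"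
      using recurrent_contraction_if_pointwise_convergent[OF assms] conv by auto
    show ?thesis by (rule geometric_decay[of N "1/2"]) (use N in auto)
  qed
  moreover have "?conv" if decay: ?decay
  proof
    fix x assume x: "x \<in> \<Omega>"
    obtain C \<rho> :: real where \<rho>: "0 < \<rho>" "\<rho> < 1"
      and b: "\<forall>x\<in>\<Omega>. \<forall>k. norm ((T ^^ k) x) \<le> C * \<rho> ^ k * norm x"
      using decay by blast
    have "(\<lambda>k. C * \<rho> ^ k * norm x) \<longlonglongrightarrow> C * 0 * norm x"
      using \<rho> by (intro tendsto_intros LIMSEQ_power_zero) auto
    then have "(\<lambda>k. C * \<rho> ^ k * norm x) \<longlonglongrightarrow> 0" by simp
    moreover have "\<forall>\<^sub>F k in sequentially. norm ((T ^^ k) x) \<le> C * \<rho> ^ k * norm x"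
      using b x by (intro always_eventually) blast
    ultimately show "(\<lambda>k. (T ^^ k) x) \<longlonglongrightarrow> 0"
      by (rule Lim_null_comparison[rotated])
  qed
  moreover have "?contr" if decay: ?decay
  proof -
    obtain C \<rho> :: real where C: "C \<ge> 1" and \<rho>: "0 < \<rho>" "\<rho> < 1"
      and b: "\<forall>x\<in>\<Omega>. \<forall>k. norm ((T ^^ k) x) \<le> C * \<rho> ^ k * norm x"
      using decay by blast
    obtain N where "\<rho> ^ N < 1 / (2 * C)"
      using real_arch_pow_inv[of "1 / (2 * C)" \<rho>] C \<rho> by auto
    then have N: "C * \<rho> ^ N < 1/2" using C by (simp add: field_simps)
    then have "N \<noteq> 0" using C by (cases N) auto
    moreover have "norm ((T ^^ N) x) \<le> 1/2 * norm x" if "x \<in> \<Omega>" for x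
    proof -
      have "norm ((T ^^ N) x) \<le> C * \<rho> ^ N * norm x" using b that by blast
      also have "\<dots> \<le> 1/2 * norm x" using N by (intro mult_right_mono) auto
      finally show ?thesis .
    qed
    ultimately show ?thesis by (intro exI[of _ N] exI[of _ "1/2"]) auto
  qed
  moreover have "?decay" if contr: ?contr
  proof -
    obtain N \<theta> where N: "N \<ge> 1" "0 < \<theta>" "\<theta> < 1"
      and b: "\<forall>x\<in>\<Omega>. norm ((T ^^ N) x) \<le> \<theta> * norm x"
      using contr by blast
    show ?thesis by (rule geometric_decay[OF _ N]) (use N b in auto)
  qed
  ultimately show ?thesis by blast
qed

end
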